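(* For any POMDP $\langle \mathcal S,\mathcal A,\mathcal O,\alpha,\beta,r,\gamma\rangle$, the solution set of the Bellman equation, i.e. the set of feasible value functions $$\{x\in\mathbb R^{\mathcal S}:\ (I-\gamma P^\pi)x=r^\pi\ \text{for some}\ \pi\in\Delta^{\mathcal O}_{\mathcal A}\},$$ is a semi-algebraic subset of $\mathbb R^{\mathcal S}$.
   Context: $\mathcal S,\mathcal A,\mathcal O$ are finite nonempty sets (states, actions, observations). $\alpha$ is a transition kernel: $\alpha(s'|s,a)\ge 0$, $\sum_{s'}\alpha(s'|s,a)=1$. $\beta$ is an observation kernel: $\beta(o|s)\ge0$, $\sum_o\beta(o|s)=1$. $r:\mathcal S\times\mathcal A\to\mathbb R$ is a reward function and $\gamma\in(0,1)$ a discount factor. $\Delta^{\mathcal O}_{\mathcal A}$ is the set of memoryless stochastic policies $\pi$: $\pi(a|o)\ge0$, $\sum_a\pi(a|o)=1$ for all $o$. For a policy $\pi$ put $\tau(a|s)=\sum_o\pi(a|o)\beta(o|s)$, $P^\pi(s'|s)=\sum_a\tau(a|s)\alpha(s'|s,a)$ (a matrix with rows $s$ and columns $s'$), and $r^\pi(s)=\sum_a\tau(a|s)r(s,a)$. *)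

theory Defs
  imports "HOL-Analysis.Analysis"
begin

definition stochastic_kernel :: "('x \<Rightarrow> 'y::finite \<Rightarrow> real) \<Rightarrow> bool" where
  "stochastic_kernel K \<longleftrightarrow> (\<forall>x y. 0 \<le> K x y) \<and> (\<forall>x. (\<Sum>y\<in>UNIV. K x y) = 1)"

text \<open>Kernels are written with the conditioning argument first: \<open>\<alpha> s a s'\<close> is
  $\alpha(s'|s,a)$, \<open>\<beta> s y\<close> is $\beta(y|s)$ and \<open>\<pi> y a\<close> is $\pi(a|y)$.
  States, actions and observations are finite types; these are automatically nonempty.\<close>

definition pomdp ::
  "('s::finite \<Rightarrow> 'a::finite \<Rightarrow> 's \<Rightarrow> real) \<Rightarrow> ('s \<Rightarrow> 'o::finite \<Rightarrow> real)
    \<Rightarrow> ('s \<Rightarrow> 'a \<Rightarrow> real) \<Rightarrow> real \<Rightarrow> bool" where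
  "pomdp \<alpha> \<beta> r \<gamma> \<longleftrightarrow>
     (\<forall>s. stochastic_kernel (\<alpha> s)) \<and> stochastic_kernel \<beta> \<and> 0 < \<gamma> \<and> \<gamma> < 1"

definition memoryless_policies :: "('o::finite \<Rightarrow> 'a::finite \<Rightarrow> real) set" where
  "memoryless_policies = {\<pi>. stochastic_kernel \<pi>}"

definition effective_policy ::
  "('s \<Rightarrow> 'o::finite \<Rightarrow> real) \<Rightarrow> ('o \<Rightarrow> 'a \<Rightarrow> real) \<Rightarrow> 's \<Rightarrow> 'a \<Rightarrow> real" where
  "effective_policy \<beta> \<pi> s a = (\<Sum>y\<in>UNIV. \<pi> y a * \<beta> s y)"

definition transition_matrix ::
  "('s::finite \<Rightarrow> 'a::finite \<Rightarrow> 's \<Rightarrow> real) \<Rightarrow> ('s \<Rightarrow> 'o::finite \<Rightarrow> real)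
    \<Rightarrow> ('o \<Rightarrow> 'a \<Rightarrow> real) \<Rightarrow> real^'s^'s" where
  "transition_matrix \<alpha> \<beta> \<pi> = (\<chi> s s'. \<Sum>a\<in>UNIV. effective_policy \<beta> \<pi> s a * \<alpha> s a s')"

definition expected_reward ::
  "('s::finite \<Rightarrow> 'o::finite \<Rightarrow> real) \<Rightarrow> ('s \<Rightarrow> 'a::finite \<Rightarrow> real)
    \<Rightarrow> ('o \<Rightarrow> 'a \<Rightarrow> real) \<Rightarrow> real^'s" where
  "expected_reward \<beta> r \<pi> = (\<chi> s. \<Sum>a\<in>UNIV. effective_policy \<beta> \<pi> s a * r s a)"

definition feasible_value_functions ::
  "('s::finite \<Rightarrow> 'a::finite \<Rightarrow> 's \<Rightarrow> real) \<Rightarrow> ('s \<Rightarrow> 'o::finite \<Rightarrow> real)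
    \<Rightarrow> ('s \<Rightarrow> 'a \<Rightarrow> real) \<Rightarrow> real \<Rightarrow> (real^'s) set" where
  "feasible_value_functions \<alpha> \<beta> r \<gamma> =
     {x. \<exists>\<pi>\<in>memoryless_policies.
           (mat 1 - \<gamma> *\<^sub>R transition_matrix \<alpha> \<beta> \<pi>) *v x = expected_reward \<beta> r \<pi>}"

text \<open>On a Euclidean space, \<^const>\<open>real_polynomial_function\<close> describes exactly the functions
  given by real polynomials in the coordinates. Non-strict inequalities need not be listed:
  \<open>f \<ge> 0\<close> is the union of \<open>f = 0\<close> and \<open>f > 0\<close>.\<close>

definition basic_semialgebraic :: "'v::euclidean_space set \<Rightarrow> bool" where
  "basic_semialgebraic A \<longleftrightarrow>
     (\<exists>F G. finite F \<and> finite G \<and> (\<forall>f\<in>F \<union> G. real_polynomial_function f) \<and>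
            A = {x. (\<forall>f\<in>F. f x = 0) \<and> (\<forall>g\<in>G. g x > 0)})"

definition semialgebraic :: "'v::euclidean_space set \<Rightarrow> bool" where
  "semialgebraic A \<longleftrightarrow>
     (\<exists>\<C>. finite \<C> \<and> (\<forall>B\<in>\<C>. basic_semialgebraic B) \<and> A = \<Union>\<C>)"

end

theory Submission
  imports Defs
begin

text \<open>For fixed \<open>x\<close> the Bellman equation and the constraints defining a policy are linear in the
  policy \<open>\<pi>\<close>, with coefficients that are polynomial in \<open>x\<close>. Hence the feasible value functions are
  a projection along coordinates in which all constraints are linear, and no general
  Tarski--Seidenberg theorem is needed: after splitting the \<open>x\<close>-space into finitely many cells
  according to the signs of the coefficients of one entry of \<open>\<pi>\<close>, that entry is removed by
  Fourier--Motzkin elimination, and the coefficients of the new system are again polynomial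
  in \<open>x\<close>.\<close>

section \<open>Semialgebraic sets\<close>

lemma basic_semialgebraic_Int:
  assumes "basic_semialgebraic A" "basic_semialgebraic B"
  shows "basic_semialgebraic (A \<inter> B)"
proof -
  obtain F G where 1: "finite F" "finite G" "\<forall>f\<in>F \<union> G. real_polynomial_function f"
      "A = {x. (\<forall>f\<in>F. f x = 0) \<and> (\<forall>g\<in>G. g x > 0)}"
    using assms(1) unfolding basic_semialgebraic_def by blast
  obtain F' G' where 2: "finite F'" "finite G'" "\<forall>f\<in>F' \<union> G'. real_polynomial_function f"
      "B = {x. (\<forall>f\<in>F'. f x = 0) \<and> (\<forall>g\<in>G'. g x > 0)}"
    using assms(2) unfolding basic_semialgebraic_def by blast
  show ?thesis
    unfolding basic_semialgebraic_def
    by (rule exI[of _ "F \<union> F'"], rule exI[of _ "G \<union> G'"]) (use 1 2 in auto)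
qed

lemma semialgebraic_basic: "basic_semialgebraic A \<Longrightarrow> semialgebraic A"
  unfolding semialgebraic_def by (rule exI[of _ "{A}"]) auto

lemma semialgebraic_Union:
  assumes "finite \<A>" "\<And>A. A \<in> \<A> \<Longrightarrow> semialgebraic A"
  shows "semialgebraic (\<Union>\<A>)"
proof -
  have "\<forall>A\<in>\<A>. \<exists>\<C>. finite \<C> \<and> (\<forall>B\<in>\<C>. basic_semialgebraic B) \<and> A = \<Union>\<C>"
    using assms(2) unfolding semialgebraic_def by blast
  then obtain f where f: "\<And>A. A \<in> \<A> \<Longrightarrow> finite (f A)"
      "\<And>A. A \<in> \<A> \<Longrightarrow> \<forall>B\<in>f A. basic_semialgebraic B"
      "\<And>A. A \<in> \<A> \<Longrightarrow> A = \<Union>(f A)"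
    by metis
  have "\<Union>\<A> = (\<Union>A\<in>\<A>. \<Union>(f A))"
    using SUP_cong[OF refl f(3), of \<A> "\<lambda>A. A"] by simp
  also have "\<dots> = \<Union>(\<Union>(f ` \<A>))"
    by blast
  finally show ?thesis
    unfolding semialgebraic_def using f(1,2) assms(1)
    by (intro exI[of _ "\<Union>(f ` \<A>)"]) blast
qed

lemma semialgebraic_Un:
  "semialgebraic A \<Longrightarrow> semialgebraic B \<Longrightarrow> semialgebraic (A \<union> B)"
  using semialgebraic_Union[of "{A, B}"] by auto

lemma semialgebraic_Int:
  assumes "semialgebraic A" "semialgebraic B"
  shows "semialgebraic (A \<inter> B)"
proof -
  obtain \<C> \<D> where C: "finite \<C>" "\<forall>B\<in>\<C>. basic_semialgebraic B" "A = \<Union>\<C>"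
    and D: "finite \<D>" "\<forall>B\<in>\<D>. basic_semialgebraic B" "B = \<Union>\<D>"
    using assms unfolding semialgebraic_def by blast
  have "A \<inter> B = \<Union>((\<lambda>(X, Y). X \<inter> Y) ` (\<C> \<times> \<D>))"
    using C(3) D(3) by auto
  with C D show ?thesis
    unfolding semialgebraic_def
    by (intro exI[of _ "(\<lambda>(X, Y). X \<inter> Y) ` (\<C> \<times> \<D>)"]) (auto intro: basic_semialgebraic_Int)
qed

lemma basic_semialgebraic_UNIV: "basic_semialgebraic UNIV"
  unfolding basic_semialgebraic_def by (intro exI[of _ "{}"]) auto

lemma semialgebraic_Ball:
  assumes "finite C" "\<And>c. c \<in> C \<Longrightarrow> semialgebraic {x. P c x}"
  shows "semialgebraic {x. \<forall>c\<in>C. P c x}"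
  using assms
proof (induction C rule: finite_induct)
  case empty
  then show ?case by (simp add: semialgebraic_basic basic_semialgebraic_UNIV)
next
  case (insert c C)
  then have "semialgebraic ({x. P c x} \<inter> {x. \<forall>c\<in>C. P c x})"
    by (intro semialgebraic_Int) auto
  then show ?case by (simp add: Collect_conj_eq)
qed

lemma semialgebraic_eq_0:
  assumes "real_polynomial_function f"
  shows "semialgebraic {x. f x = 0}"
  by (rule semialgebraic_basic, unfold basic_semialgebraic_def,
      rule exI[of _ "{f}"], rule exI[of _ "{}"]) (use assms in auto)

lemma semialgebraic_gt_0:
  assumes "real_polynomial_function f"
  shows "semialgebraic {x. f x > 0}"
  by (rule semialgebraic_basic, unfold basic_semialgebraic_def,
      rule exI[of _ "{}"], rule exI[of _ "{f}"]) (use assms in auto)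

lemma semialgebraic_lt_0:
  assumes "real_polynomial_function f"
  shows "semialgebraic {x. f x < 0}"
  using semialgebraic_gt_0[OF real_polynomial_function_minus[OF assms]] by simp

lemma semialgebraic_ge_0:
  assumes "real_polynomial_function f"
  shows "semialgebraic {x. f x \<ge> 0}"
proof -
  have "{x. f x \<ge> 0} = {x. f x = 0} \<union> {x. f x > 0}" by auto
  then show ?thesis
    using semialgebraic_Un semialgebraic_eq_0 semialgebraic_gt_0 assms by metis
qed

section \<open>Parametric Fourier--Motzkin elimination\<close>

lemma exists_between_finite:
  fixes A B :: "real set"
  assumes "finite A" "finite B" "\<And>a b. a \<in> A \<Longrightarrow> b \<in> B \<Longrightarrow> a \<le> b"
  shows "\<exists>t. (\<forall>a\<in>A. a \<le> t) \<and> (\<forall>b\<in>B. t \<le> b)"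
proof (cases "A = {}")
  case True
  with assms(2) show ?thesis
    by (metis Min_le empty_iff)
next
  case False
  \<comment> \<open>\<open>Max A\<close> is itself a member of \<open>A\<close>, so the pairwise
    hypothesis puts it below all of \<open>B\<close>. Only an empty \<open>A\<close> needs a
    separate case, where \<open>Min B\<close> serves, or any number if \<open>B\<close> is empty
    too.\<close>
  with assms show ?thesis
    by (intro exI[of _ "Max A"]) auto
qed

text \<open>Constraints in \<open>P\<close> bound t from below by - u c / a c, those in
  \<open>N\<close> from above by - u d / a d, and a common t exists once every lower bound is at
  most every upper bound. Clearing denominators gives a criterion without division, so polynomial
  coefficients will stay polynomial.\<close>

lemma linear_system_one_variable:
  fixes a u :: "'c \<Rightarrow> real"
  assumes "finite P" "finite N"
    and pos: "\<And>c. c \<in> P \<Longrightarrow> a c > 0" and neg: "\<And>c. c \<in> N \<Longrightarrow> a c < 0"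
  shows "(\<exists>t. \<forall>c\<in>P \<union> N. a c * t + u c \<ge> 0) \<longleftrightarrow> (\<forall>c\<in>P. \<forall>d\<in>N. a c * u d - a d * u c \<ge> 0)"
proof
  assume "\<exists>t. \<forall>c\<in>P \<union> N. a c * t + u c \<ge> 0"
  then obtain t where t: "\<And>c. c \<in> P \<union> N \<Longrightarrow> a c * t + u c \<ge> 0" by blast
  show "\<forall>c\<in>P. \<forall>d\<in>N. a c * u d - a d * u c \<ge> 0"
  proof (intro ballI)
    fix c d assume cd: "c \<in> P" "d \<in> N"
    \<comment> \<open>The multipliers a c and - a d are positive and chosen so that t
      cancels.\<close>
    have "0 \<le> a c * (a d * t + u d) + (- a d) * (a c * t + u c)"
      using t[of c] t[of d] pos[of c] neg[of d] cd
      by (intro add_nonneg_nonneg[OF mult_nonneg_nonneg mult_nonneg_nonneg]) auto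
    also have "\<dots> = a c * u d - a d * u c" by (simp add: algebra_simps)
    finally show "a c * u d - a d * u c \<ge> 0" .
  qed
next
  assume *: "\<forall>c\<in>P. \<forall>d\<in>N. a c * u d - a d * u c \<ge> 0"
  have le: "- u c / a c \<le> - u d / a d" if "c \<in> P" "d \<in> N" for c d
    using * that pos[of c] neg[of d] by (simp add: field_simps)
  have "\<exists>t. (\<forall>l\<in>(\<lambda>c. - u c / a c) ` P. l \<le> t) \<and> (\<forall>h\<in>(\<lambda>d. - u d / a d) ` N. t \<le> h)"
    by (rule exists_between_finite) (use le assms(1,2) in blast)+
  then obtain t where t: "\<And>c. c \<in> P \<Longrightarrow> - u c / a c \<le> t" "\<And>d. d \<in> N \<Longrightarrow> t \<le> - u d / a d"
    by blast
  have "a c * t + u c \<ge> 0" if "c \<in> P \<union> N" for c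
    using that
  proof
    assume "c \<in> P"
    with t(1)[of c] pos[of c] show ?thesis by (simp add: field_simps)
  next
    assume "c \<in> N"
    with t(2)[of c] neg[of c] show ?thesis by (simp add: field_simps)
  qed
  then show "\<exists>t. \<forall>c\<in>P \<union> N. a c * t + u c \<ge> 0" by blast
qed

text \<open>A pair \<open>(a, b)\<close> stands for the form $\sum_{i\in I} a_i(x)\,p_i + b(x)$, affine in the
  unknowns \<open>p\<close>, whose coefficients depend on the parameter \<open>x\<close>.\<close>

type_synonym ('i, 'v) param_form = "('i \<Rightarrow> 'v \<Rightarrow> real) \<times> ('v \<Rightarrow> real)"

text \<open>The assignment \<open>p\<close> is total, but its entries outside \<open>I\<close> are
  ignored. Eliminating an unknown thus only shrinks \<open>I\<close>, while the type of
  \<open>p\<close> stays fixed.\<close>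

definition form_value :: "'i set \<Rightarrow> ('i, 'v) param_form \<Rightarrow> 'v \<Rightarrow> ('i \<Rightarrow> real) \<Rightarrow> real" where
  "form_value I c x p = (\<Sum>i\<in>I. fst c i x * p i) + snd c x"

definition poly_form :: "('i, 'v::euclidean_space) param_form \<Rightarrow> bool" where
  "poly_form c \<longleftrightarrow> (\<forall>i. real_polynomial_function (fst c i)) \<and> real_polynomial_function (snd c)"

text \<open>The Fourier-Motzkin combination of \<open>c\<close> and \<open>d\<close>: its own
  coefficient at \<open>j\<close> is identically zero. Where \<open>c\<close> has a positive and
  \<open>d\<close> a negative coefficient at \<open>j\<close>, it is a positive combination of the
  two forms.\<close>

definition eliminate ::
  "'i \<Rightarrow> ('i, 'v) param_form \<Rightarrow> ('i, 'v) param_form \<Rightarrow> ('i, 'v) param_form" where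
  "eliminate j c d =
     (\<lambda>i x. fst c j x * fst d i x - fst d j x * fst c i x,
      \<lambda>x. fst c j x * snd d x - fst d j x * snd c x)"

lemma poly_form_eliminate: "poly_form c \<Longrightarrow> poly_form d \<Longrightarrow> poly_form (eliminate j c d)"
  unfolding poly_form_def eliminate_def
  by (auto intro!: real_polynomial_function_diff real_polynomial_function.intros(4))

lemma form_value_eliminate:
  "form_value I (eliminate j c d) x p =
     fst c j x * form_value I d x p - fst d j x * form_value I c x p"
  unfolding form_value_def eliminate_def
  by (simp add: sum_subtractf sum_distrib_left algebra_simps)

lemma form_value_insert:
  assumes "finite I" "j \<notin> I"
  shows "form_value (insert j I) c x p = fst c j x * p j + form_value I c x p"
  using assms unfolding form_value_def by simp

lemma form_value_upd:
  assumes "j \<notin> I"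
  shows "form_value I c x (p(j := t)) = form_value I c x p"
  using assms unfolding form_value_def by (auto intro!: sum.cong)

text \<open>Throughout such a cell the roles of the constraints are fixed: forms in \<open>P\<close>
  bound the unknown \<open>j\<close> from below, those in \<open>N\<close> from above, and those in
  \<open>Z\<close> do not involve it.\<close>

definition sign_cell ::
  "'i \<Rightarrow> ('i, 'v) param_form set \<Rightarrow> ('i, 'v) param_form set \<Rightarrow> ('i, 'v) param_form set \<Rightarrow> 'v set"
  where
  "sign_cell j P N Z = {x. (\<forall>c\<in>P. fst c j x > 0) \<and> (\<forall>c\<in>N. fst c j x < 0) \<and> (\<forall>c\<in>Z. fst c j x = 0)}"

lemma semialgebraic_sign_cell:
  assumes "finite P" "finite N" "finite Z" "\<And>c. c \<in> P \<union> N \<union> Z \<Longrightarrow> poly_form c"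
  shows "semialgebraic (sign_cell j P N Z)"
proof -
  have "sign_cell j P N Z =
      {x. \<forall>c\<in>P. fst c j x > 0} \<inter> {x. \<forall>c\<in>N. fst c j x < 0} \<inter> {x. \<forall>c\<in>Z. fst c j x = 0}"
    unfolding sign_cell_def by auto
  moreover have "real_polynomial_function (fst c j)" if "c \<in> P \<union> N \<union> Z" for c
    using assms(4)[OF that] unfolding poly_form_def by blast
  ultimately show ?thesis
    using assms(1-3)
    by (simp only:, intro semialgebraic_Int semialgebraic_Ball semialgebraic_gt_0
        semialgebraic_lt_0 semialgebraic_eq_0) auto
qed

text \<open>If \<open>P\<close> or \<open>N\<close> is empty, the unknown \<open>j\<close> is
  unbounded on one side and only \<open>Z\<close> remains.\<close>

definition eliminated_system ::
  "'i \<Rightarrow> ('i, 'v) param_form set \<Rightarrow> ('i, 'v) param_form set \<Rightarrow> ('i, 'v) param_form set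
     \<Rightarrow> ('i, 'v) param_form set" where
  "eliminated_system j P N Z = Z \<union> (\<lambda>(c, d). eliminate j c d) ` (P \<times> N)"

text \<open>The entry at \<open>j\<close> is split off as a separate real t. For fixed remaining
  entries, \<open>linear_system_one_variable\<close> applies with the values of the forms over
  \<open>I\<close> as constant terms u.\<close>

lemma exists_solution_eliminated:
  assumes "finite I" "j \<notin> I" "finite P" "finite N" "x \<in> sign_cell j P N Z"
  shows "(\<exists>p. \<forall>c\<in>P \<union> N \<union> Z. form_value (insert j I) c x p \<ge> 0) \<longleftrightarrow>
         (\<exists>p. \<forall>c\<in>eliminated_system j P N Z. form_value I c x p \<ge> 0)"
proof -
  have "(\<exists>p. \<forall>c\<in>P \<union> N \<union> Z. form_value (insert j I) c x p \<ge> 0) \<longleftrightarrow>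
        (\<exists>p t. \<forall>c\<in>P \<union> N \<union> Z. fst c j x * t + form_value I c x p \<ge> 0)"
    (is "?L \<longleftrightarrow> ?R")
  proof
    assume ?L then show ?R using assms(1,2) by (auto simp: form_value_insert)
  next
    assume ?R
    then obtain p t where "\<forall>c\<in>P \<union> N \<union> Z. fst c j x * t + form_value I c x p \<ge> 0" by blast
    \<comment> \<open>Since \<open>j\<close> is not in \<open>I\<close>, writing t into entry
      \<open>j\<close> leaves all values over \<open>I\<close> unchanged.\<close>
    then show ?L
      using assms(1,2)
      by (intro exI[of _ "p(j := t)"]) (simp add: form_value_insert form_value_upd)
  qed
  \<comment> \<open>On the cell the forms in \<open>Z\<close> have coefficient 0 at t, so the
    quantifier over t concerns only \<open>P\<close> and \<open>N\<close>.\<close>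
  also have "\<dots> \<longleftrightarrow> (\<exists>p. (\<exists>t. \<forall>c\<in>P \<union> N. fst c j x * t + form_value I c x p \<ge> 0) \<and>
                     (\<forall>c\<in>Z. form_value I c x p \<ge> 0))"
    using assms(5) unfolding sign_cell_def by (auto simp: ball_Un)
  also have "\<dots> \<longleftrightarrow> (\<exists>p. (\<forall>c\<in>P. \<forall>d\<in>N. form_value I (eliminate j c d) x p \<ge> 0) \<and>
                     (\<forall>c\<in>Z. form_value I c x p \<ge> 0))"
    using assms(3-5) unfolding sign_cell_def
    by (subst linear_system_one_variable) (auto simp: form_value_eliminate)
  also have "\<dots> \<longleftrightarrow> (\<exists>p. \<forall>c\<in>eliminated_system j P N Z. form_value I c x p \<ge> 0)"
    unfolding eliminated_system_def by (auto simp: ball_Un)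
  finally show ?thesis .
qed

text \<open>Induction on the set of unknowns, for all systems \<open>C\<close> at once, because each
  elimination replaces the system by a different one on each cell.\<close>

lemma semialgebraic_exists_linear_ge:
  fixes C :: "('i, 'v::euclidean_space) param_form set"
  assumes "finite I" "finite C" "\<And>c. c \<in> C \<Longrightarrow> poly_form c"
  shows "semialgebraic {x. \<exists>p. \<forall>c\<in>C. form_value I c x p \<ge> 0}"
  using assms
proof (induction I arbitrary: C rule: finite_induct)
  case empty
  \<comment> \<open>With no unknowns left, each form is its constant term, a polynomial in
    x.\<close>
  then show ?case
    unfolding form_value_def poly_form_def
    by (auto intro!: semialgebraic_Ball semialgebraic_ge_0)
next
  case (insert j I)
  \<comment> \<open>Overlapping \<open>P\<close> and \<open>N\<close> do no harm: a form in both
    would need a coefficient of both signs, so the cell is empty. The index set is therefore simply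
    \<open>Pow C \<times> Pow C\<close>, which is finite.\<close>
  define piece where "piece = (\<lambda>(P, N). sign_cell j P N (C - P - N) \<inter>
    {x. \<exists>p. \<forall>c\<in>eliminated_system j P N (C - P - N). form_value I c x p \<ge> 0})"
  have "{x. \<exists>p. \<forall>c\<in>C. form_value (insert j I) c x p \<ge> 0} = \<Union>(piece ` (Pow C \<times> Pow C))"
    (is "?S = ?U")
  proof (intro set_eqI)
    fix x
    have iff: "x \<in> ?S \<longleftrightarrow> (\<exists>p. \<forall>c\<in>eliminated_system j P N (C - P - N). form_value I c x p \<ge> 0)"
      if "P \<subseteq> C" "N \<subseteq> C" "x \<in> sign_cell j P N (C - P - N)" for P N
    proof -
      have "C = P \<union> N \<union> (C - P - N)" using that by blast
      moreover have "finite P" "finite N"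
        using that insert.prems(1) by (auto intro: finite_subset)
      ultimately show ?thesis
        using exists_solution_eliminated[OF insert.hyps _ _ that(3)] by simp
    qed
    \<comment> \<open>The actual signs at x select a cell containing x.\<close>
    let ?P = "{c \<in> C. fst c j x > 0}" and ?N = "{c \<in> C. fst c j x < 0}"
    have "x \<in> sign_cell j ?P ?N (C - ?P - ?N)"
      unfolding sign_cell_def by auto
    then have "x \<in> ?S \<Longrightarrow> x \<in> piece (?P, ?N)"
      using iff[of ?P ?N] unfolding piece_def by auto
    moreover have "(?P, ?N) \<in> Pow C \<times> Pow C"
      by auto
    moreover have "x \<in> ?S" if "P \<subseteq> C" "N \<subseteq> C" "x \<in> piece (P, N)" for P N
      using iff[OF that(1,2)] that(3) unfolding piece_def by simp
    ultimately show "x \<in> ?S \<longleftrightarrow> x \<in> ?U"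
      by blast
  qed
  moreover have "semialgebraic (piece (P, N))" if "P \<subseteq> C" "N \<subseteq> C" for P N
  proof -
    have fin: "finite P" "finite N" "finite (C - P - N)"
      using that insert.prems(1) by (auto intro: finite_subset)
    have "semialgebraic {x. \<exists>p. \<forall>c\<in>eliminated_system j P N (C - P - N). form_value I c x p \<ge> 0}"
    proof (rule insert.IH)
      show "finite (eliminated_system j P N (C - P - N))"
        unfolding eliminated_system_def using fin by simp
      show "poly_form c" if "c \<in> eliminated_system j P N (C - P - N)" for c
        using that \<open>P \<subseteq> C\<close> \<open>N \<subseteq> C\<close> insert.prems(2)
        unfolding eliminated_system_def by (fastforce intro: poly_form_eliminate)
    qed
    moreover have "semialgebraic (sign_cell j P N (C - P - N))"
      using fin that insert.prems(2) by (intro semialgebraic_sign_cell) auto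
    ultimately show ?thesis
      unfolding piece_def by (simp add: semialgebraic_Int)
  qed
  ultimately show ?case
    using insert.prems(1) by (auto intro!: semialgebraic_Union)
qed

text \<open>Each equation is replaced by two opposite inequalities.\<close>

lemma semialgebraic_exists_linear:
  fixes E G :: "('i, 'v::euclidean_space) param_form set"
  assumes "finite I" "finite E" "finite G" "\<And>c. c \<in> E \<union> G \<Longrightarrow> poly_form c"
  shows "semialgebraic
    {x. \<exists>p. (\<forall>c\<in>E. form_value I c x p = 0) \<and> (\<forall>c\<in>G. form_value I c x p \<ge> 0)}"
proof -
  define neg :: "('i, 'v) param_form \<Rightarrow> ('i, 'v) param_form"
    where "neg c = (\<lambda>i x. - fst c i x, \<lambda>x. - snd c x)" for c
  have val: "form_value I (neg c) x p = - form_value I c x p" for c x p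
    unfolding form_value_def neg_def by (simp add: sum_negf)
  have "poly_form (neg c)" if "poly_form c" for c
    using that unfolding poly_form_def neg_def by (auto intro!: real_polynomial_function_minus)
  then have "semialgebraic {x. \<exists>p. \<forall>c\<in>E \<union> neg ` E \<union> G. form_value I c x p \<ge> 0}"
    using assms by (intro semialgebraic_exists_linear_ge) auto
  moreover have "(\<forall>c\<in>E \<union> neg ` E \<union> G. form_value I c x p \<ge> 0) \<longleftrightarrow>
      (\<forall>c\<in>E. form_value I c x p = 0) \<and> (\<forall>c\<in>G. form_value I c x p \<ge> 0)" for x p
    by (auto simp: val ball_Un order_eq_iff)
  ultimately show ?thesis by simp
qed

section \<open>The Bellman equation as a linear system for the policy\<close>

text \<open>The residual of the Bellman equation at \<open>s\<close>, with the policy entries as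
  unknowns indexed by pairs (observation, action). The factor next to \<open>\<beta> s y\<close> is
  the one-step action value: reward plus discounted expectation of x.\<close>

definition bellman_form ::
  "('s::finite \<Rightarrow> 'a::finite \<Rightarrow> 's \<Rightarrow> real) \<Rightarrow> ('s \<Rightarrow> 'o::finite \<Rightarrow> real)
    \<Rightarrow> ('s \<Rightarrow> 'a \<Rightarrow> real) \<Rightarrow> real \<Rightarrow> 's \<Rightarrow> ('o \<times> 'a, real^'s) param_form" where
  "bellman_form \<alpha> \<beta> r \<gamma> s =
     (\<lambda>(y, a) x. - (\<beta> s y * (r s a + \<gamma> * (\<Sum>s'\<in>UNIV. \<alpha> s a s' * x $ s'))), \<lambda>x. x $ s)"

definition nonneg_form :: "'i \<Rightarrow> ('i, 'v) param_form" where
  "nonneg_form j = (\<lambda>i x. if i = j then 1 else 0, \<lambda>x. 0)"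

definition total_mass_form :: "'o \<Rightarrow> ('o \<times> 'a, 'v) param_form" where
  "total_mass_form y = (\<lambda>i x. if fst i = y then 1 else 0, \<lambda>x. - 1)"

lemma form_value_nonneg:
  "form_value UNIV (nonneg_form j) x p = p (j :: 'i::finite)"
  unfolding form_value_def nonneg_form_def by (simp add: if_distrib[of "\<lambda>t. t * _"] cong: if_cong)

lemma form_value_total_mass:
  fixes y :: "'o::finite" and p :: "'o \<times> 'a::finite \<Rightarrow> real"
  shows "form_value UNIV (total_mass_form y) x p = (\<Sum>a\<in>UNIV. p (y, a)) - 1"
proof -
  have "(\<Sum>i\<in>UNIV. (if fst i = y then 1 else 0) * p i) =
      (\<Sum>z\<in>UNIV. \<Sum>a\<in>UNIV. (if z = y then 1 else 0) * p (z, a))"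
    by (simp add: sum.cartesian_product split_def flip: UNIV_Times_UNIV)
  also have "\<dots> = (\<Sum>z\<in>UNIV. if z = y then \<Sum>a\<in>UNIV. p (z, a) else 0)"
    by (intro sum.cong) auto
  also have "\<dots> = (\<Sum>a\<in>UNIV. p (y, a))"
    by simp
  finally show ?thesis
    unfolding form_value_def total_mass_form_def by simp
qed

text \<open>Both the transition matrix and the expected reward are linear in the effective policy,
  which is linear in \<open>\<pi>\<close>; expanding and exchanging finite sums isolates the
  coefficient of each entry.\<close>

lemma form_value_bellman:
  fixes \<pi> :: "'o::finite \<Rightarrow> 'a::finite \<Rightarrow> real"
  shows "form_value UNIV (bellman_form \<alpha> \<beta> r \<gamma> s) x (case_prod \<pi>) =
    ((mat 1 - \<gamma> *\<^sub>R transition_matrix \<alpha> \<beta> \<pi>) *v x - expected_reward \<beta> r \<pi>) $ s"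
proof -
  let ?V = "\<lambda>a. \<Sum>s'\<in>UNIV. \<alpha> s a s' * x $ s'"
  have P: "(transition_matrix \<alpha> \<beta> \<pi> *v x) $ s = (\<Sum>a\<in>UNIV. effective_policy \<beta> \<pi> s a * ?V a)"
  proof -
    have "(transition_matrix \<alpha> \<beta> \<pi> *v x) $ s =
        (\<Sum>s'\<in>UNIV. \<Sum>a\<in>UNIV. effective_policy \<beta> \<pi> s a * (\<alpha> s a s' * x $ s'))"
      by (simp add: transition_matrix_def matrix_vector_mult_def sum_distrib_right mult.assoc)
    then show ?thesis
      by (subst (asm) sum.swap) (simp add: sum_distrib_left)
  qed
  have "((mat 1 - \<gamma> *\<^sub>R transition_matrix \<alpha> \<beta> \<pi>) *v x - expected_reward \<beta> r \<pi>) $ s =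
      x $ s - \<gamma> * (\<Sum>a\<in>UNIV. effective_policy \<beta> \<pi> s a * ?V a)
        - (\<Sum>a\<in>UNIV. effective_policy \<beta> \<pi> s a * r s a)"
    by (simp add: matrix_vector_mult_diff_rdistrib scaleR_matrix_vector_assoc[symmetric] P
        expected_reward_def)
  \<comment> \<open>Reward and discounted continuation carry the same effective-policy weights and
    merge into one sum.\<close>
  also have "\<dots> = x $ s - (\<Sum>a\<in>UNIV. effective_policy \<beta> \<pi> s a * (r s a + \<gamma> * ?V a))"
    by (simp add: distrib_left sum.distrib sum_distrib_left mult.left_commute)
  also have "(\<Sum>a\<in>UNIV. effective_policy \<beta> \<pi> s a * (r s a + \<gamma> * ?V a)) =
      (\<Sum>a\<in>UNIV. \<Sum>y\<in>UNIV. \<pi> y a * (\<beta> s y * (r s a + \<gamma> * ?V a)))"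
    by (simp only: effective_policy_def sum_distrib_right mult.assoc)
  also have "\<dots> = (\<Sum>y\<in>UNIV. \<Sum>a\<in>UNIV. \<pi> y a * (\<beta> s y * (r s a + \<gamma> * ?V a)))"
    by (rule sum.swap)
  also have "\<dots> = (\<Sum>(y, a)\<in>UNIV. \<pi> y a * (\<beta> s y * (r s a + \<gamma> * ?V a)))"
    by (simp add: sum.cartesian_product flip: UNIV_Times_UNIV)
  finally show ?thesis
    by (simp add: form_value_def bellman_form_def split_def sum_negf mult.commute)
qed

lemma real_polynomial_function_vec_nth: "real_polynomial_function (\<lambda>x::real^'n. x $ i)"
  by (intro real_polynomial_function.intros(1) bounded_linear_vec_nth)

lemma poly_form_bellman: "poly_form (bellman_form \<alpha> \<beta> r \<gamma> s)"
  unfolding poly_form_def bellman_form_def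
  by (auto simp: split_def intro!: real_polynomial_function_minus real_polynomial_function.intros(2-)
      real_polynomial_function_sum real_polynomial_function_vec_nth)

lemma poly_form_nonneg: "poly_form (nonneg_form j)"
  unfolding poly_form_def nonneg_form_def by (auto intro: real_polynomial_function.intros(2))

lemma poly_form_total_mass: "poly_form (total_mass_form y)"
  unfolding poly_form_def total_mass_form_def by (auto intro: real_polynomial_function.intros(2))

theorem corollary4p3:
  fixes \<alpha> :: "'s::finite \<Rightarrow> 'a::finite \<Rightarrow> 's \<Rightarrow> real"
    and \<beta> :: "'s \<Rightarrow> 'o::finite \<Rightarrow> real"
    and r :: "'s \<Rightarrow> 'a \<Rightarrow> real"
    and \<gamma> :: real
  assumes "pomdp \<alpha> \<beta> r \<gamma>"
  shows "semialgebraic (feasible_value_functions \<alpha> \<beta> r \<gamma>)"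
proof -
  define E :: "('o \<times> 'a, real^'s) param_form set"
    where "E = range (bellman_form \<alpha> \<beta> r \<gamma>) \<union> range total_mass_form"
  define G :: "('o \<times> 'a, real^'s) param_form set" where "G = range nonneg_form"
  \<comment> \<open>Normalization belongs with the equations in \<open>E\<close>, nonnegativity with
    the inequalities in \<open>G\<close>; the solutions of the joint system at x are exactly the
    policies whose Bellman equation x solves.\<close>
  have sys: "(\<forall>c\<in>E. form_value UNIV c x (case_prod \<pi>) = 0) \<and>
        (\<forall>c\<in>G. form_value UNIV c x (case_prod \<pi>) \<ge> 0) \<longleftrightarrow>
      \<pi> \<in> memoryless_policies \<and>
        (mat 1 - \<gamma> *\<^sub>R transition_matrix \<alpha> \<beta> \<pi>) *v x = expected_reward \<beta> r \<pi>" for x \<pi>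
  proof -
    have "(mat 1 - \<gamma> *\<^sub>R transition_matrix \<alpha> \<beta> \<pi>) *v x = expected_reward \<beta> r \<pi> \<longleftrightarrow>
        (\<forall>s. form_value UNIV (bellman_form \<alpha> \<beta> r \<gamma> s) x (case_prod \<pi>) = 0)"
      by (simp add: form_value_bellman vec_eq_iff)
    then show ?thesis
      unfolding E_def G_def memoryless_policies_def stochastic_kernel_def
      by (auto simp: ball_Un form_value_nonneg form_value_total_mass)
  qed
  have "feasible_value_functions \<alpha> \<beta> r \<gamma> =
      {x. \<exists>p. (\<forall>c\<in>E. form_value UNIV c x p = 0) \<and> (\<forall>c\<in>G. form_value UNIV c x p \<ge> 0)}"
    (is "?F = ?S")
  proof (intro set_eqI iffI)
    fix x assume "x \<in> ?F"
    then show "x \<in> ?S"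
      unfolding feasible_value_functions_def Bex_def sys[symmetric] by blast
  next
    fix x assume "x \<in> ?S"
    then obtain p where "(\<forall>c\<in>E. form_value UNIV c x p = 0) \<and> (\<forall>c\<in>G. form_value UNIV c x p \<ge> 0)"
      by blast
    \<comment> \<open>A solution \<open>p\<close> lives on pairs; its curried form is the required
      policy.\<close>
    then show "x \<in> ?F"
      using sys[of x "curry p"] unfolding feasible_value_functions_def case_prod_curry by blast
  qed
  moreover have "finite E" "finite G" "\<And>c. c \<in> E \<union> G \<Longrightarrow> poly_form c"
    unfolding E_def G_def by (auto intro: poly_form_bellman poly_form_nonneg poly_form_total_mass)
  ultimately show ?thesis
    using semialgebraic_exists_linear[of "UNIV :: ('o \<times> 'a) set" E G] by simp
qed

end
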